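(* Let $m,b,z\ge 1$ be integers with $z\le b$, let $K=mb$, let $N\ge K$ be an integer, and let $G=(U,C,E)$ be a user-to-cache association bipartite graph with $|U|=|C|=K$ in which every user accesses exactly $z$ caches and which satisfies the three conditions C1, C2, C3 (stated in the context) for these $m$ and $b$. Let the server have $N$ files and let the cache memory size be $M=\frac{tN}{b}$ files, where $t\ge 1$ is an integer. Then, with user-to-cache association $G$ and subpacketization level $F=b^m$, a rate of $R$ files is achievable, where $$R=\begin{cases} b-tz & \text{if } 1\le t\le \lfloor b/z\rfloor,\\ b-(z-1)\lfloor b/z\rfloor-t & \text{if } \lfloor b/z\rfloor<t<b-(z-1)\lfloor b/z\rfloor,\\ 0 & \text{if } t\ge b-(z-1)\lfloor b/z\rfloor.\end{cases}$$
   Context: Multi-access coded caching (MACC) problem. There is a central server, a set $U$ of $K$ users and a set $C$ of $K$ caches. A user-to-cache association bipartite graph is a bipartite graph $G=(U,C,E)$ with parts $U$ and $C$; user $u$ is joined to cache $c$ by an edge if and only if $u$ accesses $c$. Every user accesses exactly $z$ caches ($z$ is the access degree). The server has $N$ files $W^1,\dots,W^N$. Each file $W^i$ is split into $F$ subfiles $W^i(1),\dots,W^i(F)$ ($F$ is the subpacketization level), each consisting of $s$ bits ($s\ge1$ arbitrary). Each cache can store up to $MF$ subfiles. Placement phase (uncoded, done without knowledge of the demands): each cache is assigned a set of at most $MF$ of the $NF$ subfiles. Delivery phase: each user $k\in U$ demands one file $W^{d_k}$, $d_k\in\{1,\dots,N\}$; knowing all the demands, the server broadcasts to all users $RFs$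 bits (equivalently $RF$ blocks of $s$ bits, i.e. $R$ files) computed as a function of the files. A rate of $R$ files is achievable with association $G$, memory size $M$ and subpacketization level $F$ if there is a placement such that, for every demand vector $(d_k)_{k\in U}$, there is a broadcast of $RF$ blocks of $s$ bits from which every user $k$, using the broadcast and the contents of the $z$ caches it accesses (and knowing the demand vector), can recover its whole demanded file $W^{d_k}$, whatever the contents of the files. Conditions on $G$ for given $m,b$ with $K=mb$: C1: $G$ is a disjoint union of $m$ bipartite graphs $G_i=(K_i,C_i,E_i)$, $1\le i\le m$, with $K_i\subseteq U$, $C_i\subseteq C$, $|K_i|=|C_i|=b$, and $K_i\cap K_j=\emptyset$, $C_i\cap C_j=\emptyset$ for $i\ne j$. C2: For each $1\le i\le m$, $C_i$ can be partitioned into $z$ disjoint subsets $C_{(i,1)},\dots,C_{(i,z)}$ such that (i) $|C_{(i,l)}|=\lfloor b/z\rfloor$ for $1\le l\le z-1$ and $|C_{(i,z)}|=b-(z-1)\lfloor b/z\rfloor$; (ii) every vertex $u\in K_i$ is joined to at most one vertex of $C_{(i,l)}$ for each $1\le l\le z$. C3: For each $1\le i\le m$, $G_i$ has a perfect matching. *)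

theory Defs
  imports Complex_Main "HOL-Library.FuncSet" "HOL-Library.Disjoint_Sets"
begin

text \<open>
  The association graph is given by its two parts \<open>U\<close> (users), \<open>C\<close> (caches) and its set of edges
  \<open>E \<subseteq> U \<times> C\<close>; an edge \<open>(u, c)\<close> means that user \<open>u\<close> accesses cache \<open>c\<close>.
\<close>

definition bipartite_graph :: "'u set \<Rightarrow> 'c set \<Rightarrow> ('u \<times> 'c) set \<Rightarrow> bool" where
  "bipartite_graph U C E \<longleftrightarrow> finite U \<and> finite C \<and> E \<subseteq> U \<times> C"

definition accessed :: "('u \<times> 'c) set \<Rightarrow> 'u \<Rightarrow> 'c set" where
  "accessed E u = {c. (u, c) \<in> E}"

definition perfect_matching ::
  "'u set \<Rightarrow> 'c set \<Rightarrow> ('u \<times> 'c) set \<Rightarrow> ('u \<times> 'c) set \<Rightarrow> bool" where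
  "perfect_matching U C E P \<longleftrightarrow>
     P \<subseteq> E \<and> (\<forall>u\<in>U. \<exists>!e. e \<in> P \<and> fst e = u) \<and> (\<forall>c\<in>C. \<exists>!e. e \<in> P \<and> snd e = c)"

definition cond_C1 ::
  "'u set \<Rightarrow> 'c set \<Rightarrow> ('u \<times> 'c) set \<Rightarrow> nat \<Rightarrow> nat \<Rightarrow>
   (nat \<Rightarrow> 'u set) \<Rightarrow> (nat \<Rightarrow> 'c set) \<Rightarrow> (nat \<Rightarrow> ('u \<times> 'c) set) \<Rightarrow> bool" where
  "cond_C1 U C E m b Us Cs Es \<longleftrightarrow>
     (\<forall>i\<in>{1..m}. bipartite_graph (Us i) (Cs i) (Es i) \<and> card (Us i) = b \<and> card (Cs i) = b) \<and>
     disjoint_family_on Us {1..m} \<and> disjoint_family_on Cs {1..m} \<and>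
     U = (\<Union>i\<in>{1..m}. Us i) \<and> C = (\<Union>i\<in>{1..m}. Cs i) \<and> E = (\<Union>i\<in>{1..m}. Es i)"

definition cond_C2 ::
  "nat \<Rightarrow> nat \<Rightarrow> nat \<Rightarrow>
   (nat \<Rightarrow> 'u set) \<Rightarrow> (nat \<Rightarrow> 'c set) \<Rightarrow> (nat \<Rightarrow> ('u \<times> 'c) set) \<Rightarrow> bool" where
  "cond_C2 m b z Us Cs Es \<longleftrightarrow>
     (\<forall>i\<in>{1..m}. \<exists>D :: nat \<Rightarrow> 'c set.
        disjoint_family_on D {1..z} \<and> Cs i = (\<Union>l\<in>{1..z}. D l) \<and>
        (\<forall>l\<in>{1..z - 1}. card (D l) = b div z) \<and>
        card (D z) = b - (z - 1) * (b div z) \<and>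
        (\<forall>u\<in>Us i. \<forall>l\<in>{1..z}. card (accessed (Es i) u \<inter> D l) \<le> 1))"

definition cond_C3 ::
  "nat \<Rightarrow> (nat \<Rightarrow> 'u set) \<Rightarrow> (nat \<Rightarrow> 'c set) \<Rightarrow> (nat \<Rightarrow> ('u \<times> 'c) set) \<Rightarrow> bool" where
  "cond_C3 m Us Cs Es \<longleftrightarrow> (\<forall>i\<in>{1..m}. \<exists>P. perfect_matching (Us i) (Cs i) (Es i) P)"

text \<open>
  The pair \<open>(n, j)\<close> stands for the \<open>j\<close>-th subfile of the \<open>n\<close>-th file.  Library contents and cache
  contents are extensional functions on sets of such pairs, so that an encoder or a decoder
  receives nothing but the contents of the subfiles in question.
\<close>

definition subfiles :: "nat \<Rightarrow> nat \<Rightarrow> (nat \<times> nat) set" where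
  "subfiles N F = {1..N} \<times> {1..F}"

definition blocks :: "nat \<Rightarrow> bool list set" where
  "blocks s = {w. length w = s}"

definition file_contents :: "nat \<Rightarrow> nat \<Rightarrow> nat \<Rightarrow> (nat \<times> nat \<Rightarrow> bool list) set" where
  "file_contents N F s = subfiles N F \<rightarrow>\<^sub>E blocks s"

definition whole_file :: "nat \<Rightarrow> (nat \<times> nat \<Rightarrow> bool list) \<Rightarrow> nat \<Rightarrow> nat \<Rightarrow> bool list" where
  "whole_file F W n = (\<lambda>j\<in>{1..F}. W (n, j))"

definition placement ::
  "'c set \<Rightarrow> nat \<Rightarrow> real \<Rightarrow> nat \<Rightarrow> ('c \<Rightarrow> (nat \<times> nat) set) \<Rightarrow> bool" where
  "placement C N M F Z \<longleftrightarrow>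
     (\<forall>c\<in>C. Z c \<subseteq> subfiles N F \<and> real (card (Z c)) \<le> M * real F)"

definition cache_view ::
  "('u \<times> 'c) set \<Rightarrow> ('c \<Rightarrow> (nat \<times> nat) set) \<Rightarrow> (nat \<times> nat \<Rightarrow> bool list) \<Rightarrow>
   'u \<Rightarrow> 'c \<Rightarrow> nat \<times> nat \<Rightarrow> bool list" where
  "cache_view E Z W u = (\<lambda>c\<in>accessed E u. restrict W (Z c))"

text \<open>
  \<open>enc\<close> maps the library contents to the broadcast and \<open>dec u\<close> is the decoder of user \<open>u\<close>, applied
  to the broadcast and to the contents of the caches accessed by \<open>u\<close>.
\<close>

definition delivery ::
  "'u set \<Rightarrow> ('u \<times> 'c) set \<Rightarrow> nat \<Rightarrow> nat \<Rightarrow> nat \<Rightarrow> real \<Rightarrow> ('c \<Rightarrow> (nat \<times> nat) set) \<Rightarrow> ('u \<Rightarrow> nat) \<Rightarrow>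
   ((nat \<times> nat \<Rightarrow> bool list) \<Rightarrow> bool list list) \<Rightarrow>
   ('u \<Rightarrow> bool list list \<Rightarrow> ('c \<Rightarrow> nat \<times> nat \<Rightarrow> bool list) \<Rightarrow> nat \<Rightarrow> bool list) \<Rightarrow> bool" where
  "delivery U E N F s R Z d enc dec \<longleftrightarrow>
     (\<forall>W\<in>file_contents N F s.
        real (length (enc W)) = R * real F \<and> set (enc W) \<subseteq> blocks s \<and>
        (\<forall>u\<in>U. dec u (enc W) (cache_view E Z W u) = whole_file F W (d u)))"

text \<open>
  The encoder and the decoders may depend on the demands \<open>d\<close>; the placement, a choice of subfile
  indices, depends neither on \<open>d\<close> nor on the number \<open>s\<close> of bits per subfile.
\<close>

definition achievable ::
  "'u set \<Rightarrow> 'c set \<Rightarrow> ('u \<times> 'c) set \<Rightarrow> nat \<Rightarrow> real \<Rightarrow> nat \<Rightarrow> real \<Rightarrow> bool" where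
  "achievable U C E N M F R \<longleftrightarrow>
     (\<exists>Z. placement C N M F Z \<and>
        (\<forall>s\<ge>1. \<forall>d\<in>U \<rightarrow> {1..N}. \<exists>enc dec. delivery U E N F s R Z d enc dec))"

end

theory Submission imports Defs begin

text \<open>
  The \<open>b\<^sup>m\<close> subfiles of a file are indexed by the tuples \<open>f\<close> with \<open>f i \<in> C\<^sub>i\<close> for \<open>1 \<le> i \<le> m\<close>.  A cache
  \<open>c \<in> C\<^sub>(\<^sub>i\<^sub>,\<^sub>l\<^sub>)\<close> stores, of every file, the subfiles with \<open>f i \<in> S c\<close>, where \<open>S c\<close> contains \<open>c\<close> and is a
  subset of \<open>C\<^sub>(\<^sub>i\<^sub>,\<^sub>l\<^sub>)\<close> of size \<open>min t |C\<^sub>(\<^sub>i\<^sub>,\<^sub>l\<^sub>)|\<close>.  A user of group \<open>i\<close> accesses exactly one cache in each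
  \<open>C\<^sub>(\<^sub>i\<^sub>,\<^sub>l\<^sub>)\<close>, so it lacks precisely the subfiles whose \<open>i\<close>-th coordinate lies in a set of \<open>R\<close> values.

  The perfect matchings identify the users of group \<open>i\<close> with \<open>C\<^sub>i\<close>.  For every tuple \<open>a\<close> and every
  \<open>k < R\<close>, the server sends the sum modulo 2 of \<open>m\<close> subfiles, one for each group \<open>i\<close>: the subfile
  requested by the user \<open>u\<close> matched with \<open>a i\<close> whose index is \<open>a\<close> with the \<open>i\<close>-th coordinate replaced by
  the \<open>k\<close>-th value that \<open>u\<close> lacks.  The other summands have \<open>i\<close>-th coordinate \<open>a i\<close>, so the
  matched cache of \<open>u\<close> holds them and \<open>u\<close> recovers its own summand.
\<close>

text \<open>Bits are booleans, so a sum modulo 2 is the parity of the number of true bits; counting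
  over the set \<open>I\<close> avoids choosing an order of the summands.\<close>

definition xor_blocks :: "nat \<Rightarrow> 'i set \<Rightarrow> ('i \<Rightarrow> bool list) \<Rightarrow> bool list" where
  "xor_blocks s I g = map (\<lambda>p. odd (card {i \<in> I. g i ! p})) [0..<s]"

lemma xor_blocks_in_blocks: "xor_blocks s I g \<in> blocks s"
  by (simp add: xor_blocks_def blocks_def)

text \<open>At each bit position the parity splits into a contribution of the indices other than
  \<open>i\<close>, common to \<open>g\<close> and \<open>h\<close>, and the bit of index
  \<open>i\<close>. This is how a user strips the summands it already knows from a
  transmission.\<close>

lemma xor_blocks_cancel:
  assumes "finite I" "i \<in> I" "g i \<in> blocks s" "h i \<in> blocks s"
    and eq: "xor_blocks s I g = xor_blocks s I h"
    and others: "\<And>j. j \<in> I \<Longrightarrow> j \<noteq> i \<Longrightarrow> g j = h j"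
  shows "g i = h i"
proof (rule nth_equalityI)
  show "length (g i) = length (h i)"
    using assms by (simp add: blocks_def)
next
  fix p assume "p < length (g i)"
  then have p: "p < s" using assms by (simp add: blocks_def)
  have split: "card {j \<in> I. f j ! p} = card {j \<in> I - {i}. f j ! p} + (if f i ! p then 1 else 0)"
    for f :: "'a \<Rightarrow> bool list"
  proof (cases "f i ! p")
    case True
    then have "{j \<in> I. f j ! p} = insert i {j \<in> I - {i}. f j ! p}" using assms(2) by auto
    then show ?thesis using assms(1) True by simp
  next
    case False
    then have "{j \<in> I. f j ! p} = {j \<in> I - {i}. f j ! p}" by auto
    then show ?thesis using False by simp
  qed
  have "xor_blocks s I g ! p = xor_blocks s I h ! p" using eq by simp
  then have "odd (card {j \<in> I. g j ! p}) = odd (card {j \<in> I. h j ! p})"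
    using p by (simp add: xor_blocks_def)
  moreover have "{j \<in> I - {i}. g j ! p} = {j \<in> I - {i}. h j ! p}"
    using others by auto
  ultimately show "g i ! p = h i ! p"
    unfolding split[of g] split[of h] by (auto split: if_splits)
qed

text \<open>Decoders exist as soon as the broadcast and the cache contents determine the demanded file.\<close>

lemma delivery_if_determined:
  assumes "\<And>W. W \<in> file_contents N F s \<Longrightarrow>
             real (length (enc W)) = R * real F \<and> set (enc W) \<subseteq> blocks s"
    and det: "\<And>W W' u. \<lbrakk>W \<in> file_contents N F s; W' \<in> file_contents N F s; u \<in> U;
             enc W = enc W'; cache_view E Z W u = cache_view E Z W' u\<rbrakk>
             \<Longrightarrow> whole_file F W (d u) = whole_file F W' (d u)"
  shows "\<exists>dec. delivery U E N F s R Z d enc dec"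
proof -
  \<comment> \<open>The decoder takes any library consistent with what the user sees; by
    \<open>det\<close> the choice does not affect the demanded file.\<close>
  define dec where "dec u x v = whole_file F
    (SOME W. W \<in> file_contents N F s \<and> enc W = x \<and> cache_view E Z W u = v) (d u)" for u x v
  have "dec u (enc W) (cache_view E Z W u) = whole_file F W (d u)"
    if "W \<in> file_contents N F s" "u \<in> U" for W u
  proof -
    let ?P = "\<lambda>W'. W' \<in> file_contents N F s \<and> enc W' = enc W \<and>
      cache_view E Z W' u = cache_view E Z W u"
    have "?P (Eps ?P)" by (rule someI[of ?P W]) (use that in simp)
    then show ?thesis unfolding dec_def using det that by blast
  qed
  then have "delivery U E N F s R Z d enc dec"
    unfolding delivery_def using assms(1) by blast
  then show ?thesis by blast
qed

lemma cache_view_eqD: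
  assumes "cache_view E Z W u = cache_view E Z W' u" "c \<in> accessed E u" "x \<in> Z c"
  shows "W x = W' x"
proof -
  have "cache_view E Z W u c x = cache_view E Z W' u c x" using assms(1) by simp
  then show ?thesis using assms(2,3) by (simp add: cache_view_def)
qed

text \<open>The edges of \<open>P\<close> form the graph of \<open>\<mu>\<close>: uniqueness at the
  cache end gives injectivity; existence at the cache end with uniqueness at the user end gives
  surjectivity.\<close>

lemma bij_betw_perfect_matching:
  assumes "perfect_matching U C E P" "E \<subseteq> U \<times> C"
  obtains \<mu> where "bij_betw \<mu> U C" "\<And>u. u \<in> U \<Longrightarrow> (u, \<mu> u) \<in> E"
proof -
  have PE: "P \<subseteq> E" using assms(1) by (simp add: perfect_matching_def)
  have exU: "\<exists>c. (u, c) \<in> P" if "u \<in> U" for u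
    using assms(1) that unfolding perfect_matching_def by (metis prod.collapse)
  have exC: "\<exists>u. (u, c) \<in> P" if "c \<in> C" for c
    using assms(1) that unfolding perfect_matching_def by (metis prod.collapse)
  have uniqU: "c = c'" if "(u, c) \<in> P" "(u, c') \<in> P" for u c c'
  proof -
    have "u \<in> U" using that PE assms(2) by auto
    then have "\<exists>!e. e \<in> P \<and> fst e = u" using assms(1) by (simp add: perfect_matching_def)
    then show ?thesis using that by (metis fst_conv snd_conv)
  qed
  have uniqC: "u = u'" if "(u, c) \<in> P" "(u', c) \<in> P" for u u' c
  proof -
    have "c \<in> C" using that PE assms(2) by auto
    then have "\<exists>!e. e \<in> P \<and> snd e = c" using assms(1) by (simp add: perfect_matching_def)
    then show ?thesis using that by (metis fst_conv snd_conv)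
  qed
  obtain \<mu> where \<mu>: "\<And>u. u \<in> U \<Longrightarrow> (u, \<mu> u) \<in> P" using exU by metis
  have "inj_on \<mu> U" using \<mu> uniqC by (metis inj_onI)
  moreover have "\<mu> ` U = C"
  proof
    show "\<mu> ` U \<subseteq> C" using \<mu> PE assms(2) by auto
    show "C \<subseteq> \<mu> ` U"
    proof
      fix c assume "c \<in> C"
      then obtain u where u: "(u, c) \<in> P" using exC by blast
      then have "u \<in> U" using PE assms(2) by auto
      then show "c \<in> \<mu> ` U" using \<mu> uniqU u by blast
    qed
  qed
  ultimately show thesis using that \<mu> PE by (auto simp: bij_betw_def)
qed

section \<open>The scheme for a given choice of the sets \<open>S\<close>\<close>

text \<open>Restricting one coordinate to at most \<open>t\<close> of its \<open>b\<close> values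
  keeps at most the fraction \<open>t / b\<close> of each file, which is the memory bound. Since
  every user lacks the same number \<open>r\<close> of values, each tuple is served by
  \<open>r\<close> sums, hence \<open>r * b ^ m\<close> blocks.\<close>

lemma achievable_product_placement:
  fixes Us :: "nat \<Rightarrow> 'u set" and Cs :: "nat \<Rightarrow> 'c set" and S :: "nat \<Rightarrow> 'c \<Rightarrow> 'c set"
  assumes b: "b \<ge> 1"
    and finC: "\<And>i. i \<in> {1..m} \<Longrightarrow> finite (Cs i)"
    and cardC: "\<And>i. i \<in> {1..m} \<Longrightarrow> card (Cs i) = b"
    and disjC: "disjoint_family_on Cs {1..m}"
    and U: "U = (\<Union>i\<in>{1..m}. Us i)" and C: "C = (\<Union>i\<in>{1..m}. Cs i)"
    and acc: "\<And>i u. i \<in> {1..m} \<Longrightarrow> u \<in> Us i \<Longrightarrow> accessed E u \<subseteq> Cs i"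
    and bij: "\<And>i. i \<in> {1..m} \<Longrightarrow> bij_betw (\<mu> i) (Us i) (Cs i)"
    and match: "\<And>i u. i \<in> {1..m} \<Longrightarrow> u \<in> Us i \<Longrightarrow> \<mu> i u \<in> accessed E u"
    and S: "\<And>i c. i \<in> {1..m} \<Longrightarrow> c \<in> Cs i \<Longrightarrow> c \<in> S i c \<and> S i c \<subseteq> Cs i \<and> card (S i c) \<le> t"
    and miss: "\<And>i u. i \<in> {1..m} \<Longrightarrow> u \<in> Us i \<Longrightarrow>
                 card (Cs i - (\<Union>c\<in>accessed E u. S i c)) = r"
  shows "achievable U C E N (real t * real N / real b) (b ^ m) (real r)"
proof -

  \<comment> \<open>Numbering of the subfiles and the memory bound\<close>
  define A where "A = PiE {1..m} Cs"
  have finA: "finite A" unfolding A_def using finC by (intro finite_PiE) auto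
  have cardA: "card A = b ^ m" unfolding A_def using cardC by (simp add: card_PiE)
  obtain \<phi> where \<phi>: "bij_betw \<phi> A {1..b ^ m}"
    using finite_same_card_bij[of A "{1..b ^ m}"] finA cardA by auto
  have \<phi>A: "\<phi> f \<in> {1..b ^ m}" if "f \<in> A" for f using \<phi> that by (auto simp: bij_betw_def)
  define Z where "Z c = {(n, \<phi> f) | n f i. n \<in> {1..N} \<and> f \<in> A \<and> i \<in> {1..m} \<and> c \<in> Cs i \<and> f i \<in> S i c}"
    for c
  have cardZ: "card (Z c) \<le> N * (t * b ^ (m - 1))" if i: "i \<in> {1..m}" and c: "c \<in> Cs i" for i c
  proof -
    \<comment> \<open>As the \<open>Cs j\<close> are disjoint, \<open>c\<close> constrains only
      coordinate \<open>i\<close>; the tuples it stores thus lie in a product, whose size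
      factorises.\<close>
    define B where "B = PiE {1..m} (Cs(i := S i c))"
    have BA: "B \<subseteq> A" unfolding A_def B_def using S[OF i c] by (intro PiE_mono) auto
    have "card B = (\<Prod>j\<in>{1..m}. card ((Cs(i := S i c)) j))"
      unfolding B_def by (simp add: card_PiE)
    also have "\<dots> = card (S i c) * (\<Prod>j\<in>{1..m} - {i}. card ((Cs(i := S i c)) j))"
      using i by (subst prod.remove[of _ i]) auto
    also have "(\<Prod>j\<in>{1..m} - {i}. card ((Cs(i := S i c)) j)) = (\<Prod>j\<in>{1..m} - {i}. b)"
      using cardC by (intro prod.cong) auto
    also have "\<dots> = b ^ (m - 1)" using i by simp
    finally have "card B \<le> t * b ^ (m - 1)" using S[OF i c] by simp
    moreover have "Z c \<subseteq> {1..N} \<times> \<phi> ` B"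
    proof
      fix x assume "x \<in> Z c"
      then obtain n f j where x: "x = (n, \<phi> f)" "n \<in> {1..N}" "f \<in> A" "j \<in> {1..m}" "c \<in> Cs j" "f j \<in> S j c"
        unfolding Z_def by blast
      then have "j = i" using disjC i c unfolding disjoint_family_on_def by blast
      then have "f \<in> B" using x unfolding B_def A_def by (auto simp: PiE_iff)
      then show "x \<in> {1..N} \<times> \<phi> ` B" using x by auto
    qed
    moreover have finB: "finite B" using BA finA finite_subset by blast
    ultimately have "card (Z c) \<le> card ({1..N} \<times> \<phi> ` B)" by (intro card_mono) auto
    also have "\<dots> \<le> N * card B" using card_image_le[OF finB, of \<phi>] by (simp add: card_cartesian_product)
    also have "\<dots> \<le> N * (t * b ^ (m - 1))" using \<open>card B \<le> _\<close> by simp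
    finally show ?thesis .
  qed
  have "placement C N (real t * real N / real b) (b ^ m) Z"
    unfolding placement_def
  proof (intro ballI conjI)
    fix c assume "c \<in> C"
    then obtain i where i: "i \<in> {1..m}" and c: "c \<in> Cs i" using C by blast
    show "Z c \<subseteq> subfiles N (b ^ m)" unfolding Z_def subfiles_def using \<phi>A by auto
    have "real (card (Z c)) \<le> real (N * (t * b ^ (m - 1)))" using cardZ[OF i c] of_nat_le_iff by blast
    also have "\<dots> = real t * real N / real b * real (b ^ m)"
    proof -
      have "b ^ m = b * b ^ (m - 1)" using i by (cases m) auto
      then show ?thesis using b by (simp add: field_simps)
    qed
    finally show "real (card (Z c)) \<le> real t * real N / real b * real (b ^ m)" .
  qed

  \<comment> \<open>Broadcast and recovery for given demands\<close>
  moreover have "\<exists>enc dec. delivery U E N (b ^ m) s (real r) Z d enc dec"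
    if d: "d \<in> U \<rightarrow> {1..N}" for s and d :: "'u \<Rightarrow> nat"
  proof -
    define lacks where "lacks i u = Cs i - (\<Union>c\<in>accessed E u. S i c)" for i u
    have "\<exists>\<beta>. bij_betw \<beta> {..<r} (lacks i u)" if "i \<in> {1..m}" "u \<in> Us i" for i u
      using finite_same_card_bij[of "{..<r}" "lacks i u"] miss[OF that] finC[OF that(1)]
      by (simp add: lacks_def)
    then obtain \<beta> where \<beta>: "\<And>i u. i \<in> {1..m} \<Longrightarrow> u \<in> Us i \<Longrightarrow> bij_betw (\<beta> i u) {..<r} (lacks i u)"
      by metis
    define user where "user a i = inv_into (Us i) (\<mu> i) (a i)" for a :: "nat \<Rightarrow> 'c" and i
    have user: "user a i \<in> Us i" if "a \<in> A" "i \<in> {1..m}" for a i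
      using bij[OF that(2)] that unfolding user_def A_def
      by (metis PiE_mem bij_betw_def inv_into_into)
    define idx where "idx a k i = (d (user a i), \<phi> (a(i := \<beta> i (user a i) k)))" for a k i
    have upd: "a(i := \<beta> i (user a i) k) \<in> A" if "a \<in> A" "i \<in> {1..m}" "k < r" for a i k
    proof -
      have "\<beta> i (user a i) k \<in> Cs i"
        using bij_betwE[OF \<beta>[OF that(2) user[OF that(1,2)]]] that(3) by (auto simp: lacks_def)
      then show ?thesis using that unfolding A_def by (auto simp: PiE_iff extensional_def)
    qed
    have dU: "d u \<in> {1..N}" if "i \<in> {1..m}" "u \<in> Us i" for i u
      using d that U by blast
    have W_block: "W (d u, \<phi> f) \<in> blocks s"
      if "W \<in> file_contents N (b ^ m) s" "i \<in> {1..m}" "u \<in> Us i" "f \<in> A" for W u i f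
      using that dU[OF that(2,3)] \<phi>A[OF that(4)]
      by (auto simp: file_contents_def subfiles_def PiE_iff)
    have "finite (A \<times> {..<r})" using finA by simp
    then obtain L where L: "set L = A \<times> {..<r}" "distinct L" using finite_distinct_list by metis
    have lenL: "length L = b ^ m * r"
      using distinct_card[OF L(2)] L(1) cardA by (simp add: card_cartesian_product)
    define enc where "enc W = map (\<lambda>(a, k). xor_blocks s {1..m} (\<lambda>i. W (idx a k i))) L" for W
    have encD: "xor_blocks s {1..m} (\<lambda>i. W (idx a k i)) = xor_blocks s {1..m} (\<lambda>i. W' (idx a k i))"
      if "enc W = enc W'" "a \<in> A" "k < r" for W W' a k
      using that L(1) unfolding enc_def by (auto simp: map_eq_conv)
    \<comment> \<open>It remains to compare two libraries that give the same broadcast and look the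
      same to \<open>u\<close>; no explicit decoder is needed.\<close>
    have "\<exists>dec. delivery U E N (b ^ m) s (real r) Z d enc dec"
    proof (rule delivery_if_determined)
      show "real (length (enc W)) = real r * real (b ^ m) \<and> set (enc W) \<subseteq> blocks s" for W
        using lenL xor_blocks_in_blocks by (auto simp: enc_def)
    next
      fix W W' u
      assume W: "W \<in> file_contents N (b ^ m) s" and W': "W' \<in> file_contents N (b ^ m) s"
        and "u \<in> U" and e: "enc W = enc W'" and view: "cache_view E Z W u = cache_view E Z W' u"
      then obtain i where i: "i \<in> {1..m}" and u: "u \<in> Us i" using U by blast
      have cached: "W (n, \<phi> f) = W' (n, \<phi> f)"
        if "n \<in> {1..N}" "f \<in> A" "c \<in> accessed E u" "f i \<in> S i c" for n f c
      proof -
        have "(n, \<phi> f) \<in> Z c" using that i acc[OF i u] unfolding Z_def by blast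
        then show ?thesis using cache_view_eqD[OF view that(3)] by blast
      qed
      have "W (d u, \<phi> f) = W' (d u, \<phi> f)" if f: "f \<in> A" for f
      proof (cases "f i \<in> lacks i u")
        case False
        moreover have "f i \<in> Cs i" using f i by (auto simp: A_def)
        ultimately show ?thesis using cached[OF dU[OF i u] f] by (auto simp: lacks_def)
      next
        case True
        then obtain k where k: "k < r" "\<beta> i u k = f i"
          using \<beta>[OF i u] by (auto simp: bij_betw_def image_iff) (metis lessThan_iff imageE)
        \<comment> \<open>Inverts the index rule: in the \<open>k\<close>-th sum for
          \<open>a\<close>, the summand of group \<open>i\<close> puts
          \<open>\<beta> i u k = f i\<close> back into coordinate \<open>i\<close>, so it is the
          wanted subfile.\<close>
        define a where "a = f(i := \<mu> i u)"
        have \<mu>C: "\<mu> i u \<in> Cs i" using bij[OF i] u by (auto simp: bij_betw_def)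
        have a: "a \<in> A" using f i \<mu>C unfolding a_def A_def by (auto simp: PiE_iff extensional_def)
        have ua: "user a i = u"
          using bij[OF i] u unfolding user_def a_def by (simp add: bij_betw_inv_into_left)
        have idx_i: "idx a k i = (d u, \<phi> f)"
          unfolding idx_def ua k(2) by (simp add: a_def)
        have "W (idx a k i) = W' (idx a k i)"
        proof (rule xor_blocks_cancel[where I = "{1..m}" and i = i and s = s])
          show "xor_blocks s {1..m} (\<lambda>i. W (idx a k i)) = xor_blocks s {1..m} (\<lambda>i. W' (idx a k i))"
            using encD[OF e a k(1)] .
          show "W (idx a k i) \<in> blocks s" "W' (idx a k i) \<in> blocks s"
            using W_block W W' i u f unfolding idx_i by blast+
          fix j assume j: "j \<in> {1..m}" "j \<noteq> i"
          let ?g = "a(j := \<beta> j (user a j) k)"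
          \<comment> \<open>Changing coordinate \<open>j\<close> leaves coordinate \<open>i\<close>
            at \<open>\<mu> i u\<close>, a member of its own set; hence the matched cache holds this
            summand.\<close>
          have "?g i \<in> S i (\<mu> i u)" using j S[OF i \<mu>C] by (simp add: a_def)
          then show "W (idx a k j) = W' (idx a k j)"
            unfolding idx_def
            using cached[OF dU[OF j(1) user[OF a j(1)]] upd[OF a j(1) k(1)] match[OF i u]] by blast
        qed (use i in auto)
        then show ?thesis unfolding idx_i .
      qed
      moreover have "\<exists>f\<in>A. p = \<phi> f" if "p \<in> {1..b ^ m}" for p
        using that \<phi> by (auto simp: bij_betw_def)
      ultimately show "whole_file (b ^ m) W (d u) = whole_file (b ^ m) W' (d u)"
        unfolding whole_file_def by (intro restrict_ext) blast
    qed
    then show ?thesis by blast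
  qed
  ultimately show ?thesis unfolding achievable_def by blast
qed

section \<open>The choice of the sets \<open>S\<close> within one group\<close>

text \<open>Pigeonhole: \<open>z\<close> terms, each at most 1, add up to \<open>z\<close> only if
  none is smaller.\<close>

lemma card_Int_eq_1_of_le_1:
  assumes "finite X" "card X = z" "X \<subseteq> (\<Union>l\<in>{1..z}. D l)" "disjoint_family_on D {1..z}"
    and le: "\<And>l. l \<in> {1..z} \<Longrightarrow> card (X \<inter> D l) \<le> 1"
    and l: "l \<in> {1..z}"
  shows "card (X \<inter> D l) = 1"
proof -
  have "X = (\<Union>l\<in>{1..z}. X \<inter> D l)" using assms(3) by blast
  then have "card X = card (\<Union>l\<in>{1..z}. X \<inter> D l)" by simp
  also have "\<dots> = (\<Sum>l\<in>{1..z}. card (X \<inter> D l))"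
    using assms(1,4) by (intro card_UN_disjoint) (auto simp: disjoint_family_on_def)
  finally have "(\<Sum>l\<in>{1..z}. card (X \<inter> D l)) = (\<Sum>l\<in>{1..z}. 1)" using assms(2) by simp
  from sum_mono_inv[OF this] le l show ?thesis by simp
qed

text \<open>Each \<open>S c\<close> stays inside the cell \<open>D l\<close> of \<open>c\<close>, so
  the cells decouple: \<open>X\<close> meets every cell in a single cache, whose set removes
  \<open>min t (card (D l))\<close> values there and none elsewhere. Truncated subtraction covers
  cells with fewer than \<open>t\<close> elements. One \<open>S\<close> serves all \<open>X\<close>,
  since a cache cannot adapt to the user reading it.\<close>

lemma ex_cached_sets:
  assumes "finite Y" "t \<ge> 1"
    and disj: "disjoint_family_on D {1..z}" and Y: "Y = (\<Union>l\<in>{1..z}. D l)"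
  shows "\<exists>S. (\<forall>c\<in>Y. c \<in> S c \<and> S c \<subseteq> Y \<and> card (S c) \<le> t) \<and>
    (\<forall>X\<subseteq>Y. card X = z \<longrightarrow> (\<forall>l\<in>{1..z}. card (X \<inter> D l) \<le> 1) \<longrightarrow>
      card (Y - (\<Union>c\<in>X. S c)) = (\<Sum>l\<in>{1..z}. card (D l) - t))"
proof -
  have finD: "finite (D l)" if "l \<in> {1..z}" for l
    using assms(1) Y that by (auto intro: finite_subset)
  have "\<exists>B. c \<in> B \<and> B \<subseteq> D l \<and> card B = min t (card (D l))" if "l \<in> {1..z}" "c \<in> D l" for l c
  proof -
    \<comment> \<open>\<open>t \<ge> 1\<close> leaves room for \<open>c\<close> itself, which the
      set must contain.\<close>
    have "card {c} \<le> min t (card (D l))"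
      using assms(2) that finD[OF that(1)] by (simp add: Suc_le_eq card_gt_0_iff) blast
    then show ?thesis
      using exists_subset_between[of "{c}" "min t (card (D l))" "D l"] finD that by auto
  qed
  then obtain T where T: "\<And>l c. l \<in> {1..z} \<Longrightarrow> c \<in> D l \<Longrightarrow>
      c \<in> T l c \<and> T l c \<subseteq> D l \<and> card (T l c) = min t (card (D l))" by metis
  have "\<exists>l. c \<in> Y \<longrightarrow> l \<in> {1..z} \<and> c \<in> D l" for c using Y by blast
  then obtain part where part: "\<And>c. c \<in> Y \<Longrightarrow> part c \<in> {1..z} \<and> c \<in> D (part c)" by metis
  have part_eq: "part c = l" if "l \<in> {1..z}" "c \<in> D l" for l c
    using part[of c] that Y disj unfolding disjoint_family_on_def by blast
  define S where "S c = T (part c) c" for c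
  have S: "c \<in> S c \<and> S c \<subseteq> D l \<and> card (S c) = min t (card (D l))"
    if "l \<in> {1..z}" "c \<in> D l" for l c
    using T[OF that] part_eq[OF that] by (simp add: S_def)
  have "card (Y - (\<Union>c\<in>X. S c)) = (\<Sum>l\<in>{1..z}. card (D l) - t)"
    if X: "X \<subseteq> Y" "card X = z" "\<forall>l\<in>{1..z}. card (X \<inter> D l) \<le> 1" for X
  proof -
    have finX: "finite X" using X(1) assms(1) finite_subset by blast
    have "\<exists>c. X \<inter> D l = {c}" if "l \<in> {1..z}" for l
      using card_Int_eq_1_of_le_1[OF finX X(2) _ disj _ that] X Y by (simp add: card_1_singleton_iff)
    then obtain x where x: "\<And>l. l \<in> {1..z} \<Longrightarrow> X \<inter> D l = {x l}" by metis
    have "Y - (\<Union>c\<in>X. S c) = (\<Union>l\<in>{1..z}. D l - S (x l))"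
    proof (intro equalityI subsetI)
      fix y assume y: "y \<in> Y - (\<Union>c\<in>X. S c)"
      then obtain l where l: "l \<in> {1..z}" "y \<in> D l" using Y by blast
      then show "y \<in> (\<Union>l\<in>{1..z}. D l - S (x l))" using x[OF l(1)] y by blast
    next
      fix y assume "y \<in> (\<Union>l\<in>{1..z}. D l - S (x l))"
      then obtain l where l: "l \<in> {1..z}" "y \<in> D l" "y \<notin> S (x l)" by blast
      \<comment> \<open>Sets of caches from other cells cannot reach \<open>y\<close>, and the only
        cache of \<open>X\<close> in the cell of \<open>y\<close> is \<open>x l\<close>.\<close>
      have "y \<notin> S c" if "c \<in> X" for c
      proof
        assume y: "y \<in> S c"
        have c: "part c \<in> {1..z}" "c \<in> D (part c)" using part that X(1) by blast+
        then have "y \<in> D (part c)" using S y by blast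
        then have "part c = l" using c(1) l(1,2) disj unfolding disjoint_family_on_def by blast
        then have "c = x l" using x[OF l(1)] c(2) that by blast
        then show False using y l(3) by simp
      qed
      then show "y \<in> Y - (\<Union>c\<in>X. S c)" using l Y by blast
    qed
    moreover have "card (\<Union>l\<in>{1..z}. D l - S (x l)) = (\<Sum>l\<in>{1..z}. card (D l - S (x l)))"
    proof (rule card_UN_disjoint)
      show "\<forall>i\<in>{1..z}. \<forall>j\<in>{1..z}. i \<noteq> j \<longrightarrow> (D i - S (x i)) \<inter> (D j - S (x j)) = {}"
        using disj unfolding disjoint_family_on_def by blast
    qed (use finD in auto)
    moreover have "card (D l - S (x l)) = card (D l) - t" if l: "l \<in> {1..z}" for l
    proof -
      have "x l \<in> D l" using x[OF l] by blast
      then have "S (x l) \<subseteq> D l" "card (S (x l)) = min t (card (D l))" using S[OF l] by blast+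
      then show ?thesis using finD[OF l] by (simp add: card_Diff_subset finite_subset)
    qed
    ultimately show ?thesis by simp
  qed
  moreover have "c \<in> S c \<and> S c \<subseteq> Y \<and> card (S c) \<le> t" if "c \<in> Y" for c
    using S[of "part c" c] part[OF that] Y by auto
  ultimately show ?thesis by blast
qed

text \<open>The first \<open>z - 1\<close> cells have size \<open>b div z\<close> and the last is at
  least as large. For \<open>t \<le> b div z\<close> nothing is truncated; for larger
  \<open>t\<close> only the last cell can contribute.\<close>

lemma lacking_count:
  fixes b z t :: nat and R :: real
  assumes "z \<ge> 1" "z \<le> b"
    and card_D: "\<forall>l\<in>{1..z - 1}. card (D l) = b div z" "card (D z) = b - (z - 1) * (b div z)"
    and R: "R = (if t \<le> b div z then real b - real t * real z
              else if real t < real b - (real z - 1) * real (b div z)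
                then real b - (real z - 1) * real (b div z) - real t
              else 0)"
  shows "real (\<Sum>l\<in>{1..z}. card (D l) - t) = R"
proof -
  obtain w where w: "z = Suc w" using assms(1) by (cases z) auto
  define q where "q = b div z"
  have "z * q \<le> b" unfolding q_def by simp
  then have wq: "w * q + q \<le> b" using w by simp
  have "(\<Sum>l\<in>{1..z}. card (D l) - t) = (\<Sum>l\<in>{1..w}. card (D l) - t) + (card (D z) - t)"
    using w by simp
  also have "(\<Sum>l\<in>{1..w}. card (D l) - t) = w * (q - t)"
    using card_D(1) w by (simp add: q_def)
  finally have sum: "(\<Sum>l\<in>{1..z}. card (D l) - t) = w * (q - t) + (b - w * q - t)"
    using card_D(2) w by (simp add: q_def)
  have cast: "real (b - w * q) = real b - real w * real q" using wq by (simp add: of_nat_diff)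
  have R': "R = (if t \<le> q then real b - real t * (real w + 1)
      else if real t < real b - real w * real q then real b - real w * real q - real t else 0)"
    unfolding R q_def w by simp
  have "real (w * (q - t) + (b - w * q - t)) = R"
  proof (cases "t \<le> q")
    case True
    then have "real (b - w * q - t) = real b - real w * real q - real t"
      using wq cast by (subst of_nat_diff) auto
    moreover have "real (w * (q - t)) = real w * real q - real w * real t"
      using True by (simp add: of_nat_diff right_diff_distrib)
    ultimately have "real (w * (q - t) + (b - w * q - t)) = real b - real t * (real w + 1)"
      unfolding of_nat_add by (simp only:) (simp add: algebra_simps)
    then show ?thesis using True unfolding R' by simp
  next
    case False
    \<comment> \<open>Truncated subtraction on naturals yields exactly the last two cases of
      \<open>R\<close>.\<close>
    have "real (b - w * q - t) =
      (if real t < real b - real w * real q then real b - real w * real q - real t else 0)"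
      unfolding cast[symmetric] of_nat_less_iff by (simp only: of_nat_diff_if) simp
    then show ?thesis using False unfolding R' by simp
  qed
  then show ?thesis using sum by simp
qed

section \<open>Combination of the groups under the three conditions\<close>

theorem theorem2:
  fixes U :: "'u set" and C :: "'c set" and E :: "('u \<times> 'c) set"
    and Us :: "nat \<Rightarrow> 'u set" and Cs :: "nat \<Rightarrow> 'c set" and Es :: "nat \<Rightarrow> ('u \<times> 'c) set"
    and m b z K N t :: nat and M R :: real
  assumes "m \<ge> 1" and "b \<ge> 1" and "z \<ge> 1" and "z \<le> b"
    and "K = m * b" and "N \<ge> K"
    and "bipartite_graph U C E" and "card U = K" and "card C = K"
    and "\<forall>u\<in>U. card (accessed E u) = z"
    and "cond_C1 U C E m b Us Cs Es"
    and "cond_C2 m b z Us Cs Es"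
    and "cond_C3 m Us Cs Es"
    and "t \<ge> 1" and "M = real t * real N / real b"
    and "R = (if t \<le> b div z then real b - real t * real z
              else if real t < real b - (real z - 1) * real (b div z)
                then real b - (real z - 1) * real (b div z) - real t
              else 0)"
  shows "achievable U C E N M (b ^ m) R"
proof -
  note C1 = \<open>cond_C1 U C E m b Us Cs Es\<close>[unfolded cond_C1_def bipartite_graph_def]
  have accE: "accessed E u = accessed (Es i) u" if "i \<in> {1..m}" "u \<in> Us i" for i u
  proof -
    \<comment> \<open>The user sets of the groups are disjoint, so an edge at \<open>u\<close> can
      only come from \<open>Es i\<close>.\<close>
    have "(u, c) \<in> Es i" if c: "(u, c) \<in> E" for c
    proof -
      obtain j where j: "j \<in> {1..m}" "(u, c) \<in> Es j" using C1 c by blast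
      then have "u \<in> Us j" using C1 by blast
      then have "j = i" using C1 j(1) that \<open>i \<in> {1..m}\<close> \<open>u \<in> Us i\<close>
        unfolding disjoint_family_on_def by blast
      then show ?thesis using j by simp
    qed
    then show ?thesis using C1 that unfolding accessed_def by blast
  qed
  have acc: "accessed E u \<subseteq> Cs i" if "i \<in> {1..m}" "u \<in> Us i" for i u
    using accE[OF that] C1 that by (auto simp: accessed_def)
  have "\<exists>f. bij_betw f (Us i) (Cs i) \<and> (\<forall>u\<in>Us i. (u, f u) \<in> Es i)" if i: "i \<in> {1..m}" for i
  proof -
    obtain P where "perfect_matching (Us i) (Cs i) (Es i) P"
      using \<open>cond_C3 m Us Cs Es\<close> i unfolding cond_C3_def by blast
    moreover have "Es i \<subseteq> Us i \<times> Cs i" using C1 i by blast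
    ultimately show ?thesis using bij_betw_perfect_matching by metis
  qed
  then obtain \<mu> where \<mu>: "\<And>i. i \<in> {1..m} \<Longrightarrow> bij_betw (\<mu> i) (Us i) (Cs i)"
      "\<And>i u. i \<in> {1..m} \<Longrightarrow> u \<in> Us i \<Longrightarrow> (u, \<mu> i u) \<in> Es i" by metis
  \<comment> \<open>\<open>R\<close> turns out to be a natural number, so rounding changes nothing.
    Defining \<open>r\<close> from \<open>R\<close> makes it one number for all groups, although
    \<open>D\<close> is chosen group by group.\<close>
  define r where "r = nat \<lfloor>R\<rfloor>"
  have group: "real r = R \<and> (\<exists>S. (\<forall>c\<in>Cs i. c \<in> S c \<and> S c \<subseteq> Cs i \<and> card (S c) \<le> t) \<and>
      (\<forall>u\<in>Us i. card (Cs i - (\<Union>c\<in>accessed E u. S c)) = r))" if i: "i \<in> {1..m}" for i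
  proof -
    obtain D where D: "disjoint_family_on D {1..z}" "Cs i = (\<Union>l\<in>{1..z}. D l)"
      "\<forall>l\<in>{1..z - 1}. card (D l) = b div z" "card (D z) = b - (z - 1) * (b div z)"
      "\<forall>u\<in>Us i. \<forall>l\<in>{1..z}. card (accessed (Es i) u \<inter> D l) \<le> 1"
      using \<open>cond_C2 m b z Us Cs Es\<close> i unfolding cond_C2_def by blast
    have R: "real (\<Sum>l\<in>{1..z}. card (D l) - t) = R"
      using lacking_count[OF assms(3,4) D(3,4) assms(16)] .
    then have r: "(\<Sum>l\<in>{1..z}. card (D l) - t) = r" unfolding r_def by (metis floor_of_nat nat_int)
    have "finite (Cs i)" using C1 i by blast
    from ex_cached_sets[OF this \<open>t \<ge> 1\<close> D(1,2)] obtain S where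
      S: "\<forall>c\<in>Cs i. c \<in> S c \<and> S c \<subseteq> Cs i \<and> card (S c) \<le> t"
        "\<And>X. X \<subseteq> Cs i \<Longrightarrow> card X = z \<Longrightarrow> \<forall>l\<in>{1..z}. card (X \<inter> D l) \<le> 1 \<Longrightarrow>
          card (Cs i - (\<Union>c\<in>X. S c)) = r" unfolding r by blast
    have "card (Cs i - (\<Union>c\<in>accessed E u. S c)) = r" if u: "u \<in> Us i" for u
    proof (rule S(2)[OF acc[OF i u]])
      show "card (accessed E u) = z" using assms(10) C1 i u by blast
      show "\<forall>l\<in>{1..z}. card (accessed E u \<inter> D l) \<le> 1" using D(5) u accE[OF i u] by simp
    qed
    then show ?thesis using S(1) R r by blast
  qed
  \<comment> \<open>\<open>m \<ge> 1\<close> supplies a group in which \<open>R\<close> is seen to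
    be a cardinality.\<close>
  have rR: "real r = R" using group[of 1] \<open>m \<ge> 1\<close> by simp
  obtain S where S: "\<And>i. i \<in> {1..m} \<Longrightarrow> (\<forall>c\<in>Cs i. c \<in> S i c \<and> S i c \<subseteq> Cs i \<and> card (S i c) \<le> t) \<and>
      (\<forall>u\<in>Us i. card (Cs i - (\<Union>c\<in>accessed E u. S i c)) = r)" using group by metis
  have "achievable U C E N (real t * real N / real b) (b ^ m) (real r)"
  proof (rule achievable_product_placement[where Us = Us and Cs = Cs and S = S and \<mu> = \<mu>])
    show "\<mu> i u \<in> accessed E u" if "i \<in> {1..m}" "u \<in> Us i" for i u
      using \<mu>(2)[OF that] accE[OF that] by (simp add: accessed_def)
  qed (use C1 S \<mu>(1) acc \<open>b \<ge> 1\<close> in blast)+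
  then show ?thesis unfolding rR \<open>M = real t * real N / real b\<close> .
qed

end
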